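(* Given an integer $n\ge1$, the zeros $\tau_1,\dots,\tau_n$ of the Legendre polynomial $P_n$, and $t\in(-1,1)$, all the values $F^n_0(t),F^n_1(t),\dots,F^n_n(t)$ of the Gauss--Legendre polynomials can be evaluated in $O(n^2)$ time by applying Horner's scheme (in powers of $t+1$) to the representations $$F^n_i(t)=\sum_{k=1}^{n}\frac{n}{2k}\left(P_{n-1}(\tau_i)b^{(i)}_{k-1}-P_{n-1}(\tau_{i+1})b^{(i+1)}_{k-1}\right)(t+1)^k\quad(1\le i\le n-1),$$ $$F^n_0(t)=1-\frac{n}{2}P_{n-1}(\tau_1)\sum_{k=1}^{n}\frac{1}{k}b^{(1)}_{k-1}(t+1)^k,\qquad F^n_n(t)=\frac{n}{2}P_{n-1}(\tau_n)\sum_{k=1}^{n}\frac{1}{k}b^{(n)}_{k-1}(t+1)^k,$$ where the cost includes computing the coefficients. Consequently, for every $d\ge1$ and all control points $W_0,\dots,W_n\in\mathbb E^d$, the point $\sum_{i=0}^n W_iF^n_i(t)$ of the Gauss--Legendre curve of degree $n$ can be computed component-wise with computational complexity $O(n^2+dn)$.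
   Context: Time/computational complexity means the number of real arithmetic operations, with implied constants independent of $n,d,t$ and the control points; the zeros of $P_n$ are assumed to be known (precomputed). $P_k$ is the $k$th Legendre polynomial, $P_k(1)=1$; $-1<\tau_1<\cdots<\tau_n<1$ are the zeros of $P_n$; the numbers $b^{(i)}_k$ are defined by $\frac{P_n(x)}{x-\tau_i}=\sum_{k=0}^{n-1}b^{(i)}_k(x+1)^k$ for $1\le i\le n$. $\mathbb E^d$ is $d$-dimensional Euclidean space. Gauss--Legendre polynomials: set $G^n_0(t)\equiv\frac12$, $G^n_{n+1}(t)\equiv-\frac12$, and for $i=1,\dots,n$ $$G^n_i(t):=\frac{nP_{n-1}(\tau_i)}{2}\int_{-1}^{t}\frac{P_n(x)}{x-\tau_i}\,dx-\frac12 .$$ Then $F^n_i(t):=G^n_i(t)-G^n_{i+1}(t)$ for $i=0,1,\dots,n$. The Gauss--Legendre curve of degree $n$ with control points $W_0,\dots,W_n\in\mathbb E^d$ is $t\mapsto\sum_{i=0}^nW_iF^n_i(t)$, $t\in[-1,1]$. *)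

theory Defs
  imports "HOL-Analysis.Analysis"
begin

section \<open>Gauss--Legendre polynomials\<close>

text \<open>Bonnet's recurrence \<open>(k + 2) P\<^bsub>k+2\<^esub> = (2k + 3) x P\<^bsub>k+1\<^esub> - (k + 1) P\<^sub>k\<close>, normalised by
  \<open>P\<^sub>k(1) = 1\<close>.\<close>

fun legendre :: "nat \<Rightarrow> real poly" where
  "legendre 0 = 1"
| "legendre (Suc 0) = [:0, 1:]"
| "legendre (Suc (Suc k)) =
     smult (1 / real (k + 2))
       (smult (real (2 * k + 3)) ([:0, 1:] * legendre (Suc k)) - smult (real (k + 1)) (legendre k))"

lemma poly_legendre_1: "poly (legendre k) 1 = 1"
  by (induction k rule: legendre.induct) (simp_all add: field_simps)

definition legendre_zeros :: "nat \<Rightarrow> (nat \<Rightarrow> real) \<Rightarrow> bool" where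
  "legendre_zeros n \<tau> \<longleftrightarrow>
     strict_mono_on {1..n} \<tau> \<and> \<tau> ` {1..n} \<subseteq> {-1<..<1} \<and> {x. poly (legendre n) x = 0} = \<tau> ` {1..n}"

text \<open>The coefficients \<open>b\<^sup>(\<^sup>i\<^sup>)\<^sub>k\<close>, \<open>k < n\<close>, of the polynomial \<open>P\<^sub>n(x) / (x - \<tau>\<^sub>i)\<close> in powers of \<open>x + 1\<close>.
  The condition for \<open>k \<ge> n\<close> only serves to make the coefficient function unique.\<close>

definition quot_coeff :: "nat \<Rightarrow> (nat \<Rightarrow> real) \<Rightarrow> nat \<Rightarrow> nat \<Rightarrow> real" where
  "quot_coeff n \<tau> i =
     (THE b. (\<forall>x. x \<noteq> \<tau> i \<longrightarrow> poly (legendre n) x / (x - \<tau> i) = (\<Sum>k<n. b k * (x + 1) ^ k)) \<and>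
             (\<forall>k\<ge>n. b k = 0))"

text \<open>At \<open>x = \<tau>\<^sub>i\<close> the integrand takes the junk value \<open>0\<close>, which does not affect the integral.\<close>

definition gl_G :: "nat \<Rightarrow> (nat \<Rightarrow> real) \<Rightarrow> nat \<Rightarrow> real \<Rightarrow> real" where
  "gl_G n \<tau> i t =
     (if i = 0 then 1 / 2
      else if i = n + 1 then - 1 / 2
      else real n * poly (legendre (n - 1)) (\<tau> i) / 2 *
             integral {-1..t} (\<lambda>x. poly (legendre n) x / (x - \<tau> i)) - 1 / 2)"

definition gl_F :: "nat \<Rightarrow> (nat \<Rightarrow> real) \<Rightarrow> nat \<Rightarrow> real \<Rightarrow> real" where
  "gl_F n \<tau> i t = gl_G n \<tau> i t - gl_G n \<tau> (i + 1) t"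

text \<open>Points of \<open>d\<close>-dimensional Euclidean space are given by their coordinates with indices
  \<open>1, \<dots>, d\<close>, since a single algorithm has to serve all \<open>d\<close>; \<open>W i j\<close> is the \<open>j\<close>-th coordinate
  of the control point \<open>W\<^sub>i\<close>.\<close>

definition gl_curve :: "nat \<Rightarrow> (nat \<Rightarrow> real) \<Rightarrow> (nat \<Rightarrow> nat \<Rightarrow> real) \<Rightarrow> real \<Rightarrow> nat \<Rightarrow> real" where
  "gl_curve n \<tau> W t = (\<lambda>j. \<Sum>i\<le>n. W i j * gl_F n \<tau> i t)"

text \<open>The coefficient of \<open>(t + 1)\<^sup>k\<close>, \<open>0 \<le> k \<le> n\<close>, in the representation of \<open>F\<^sup>n\<^sub>i(t)\<close> that is
  evaluated by Horner's scheme.\<close>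

definition gl_coeff :: "nat \<Rightarrow> (nat \<Rightarrow> real) \<Rightarrow> nat \<Rightarrow> nat \<Rightarrow> real" where
  "gl_coeff n \<tau> i k =
     (if k = 0 then (if i = 0 then 1 else 0)
      else if i = 0 then
        - (real n / 2 * poly (legendre (n - 1)) (\<tau> 1) * (1 / real k * quot_coeff n \<tau> 1 (k - 1)))
      else if i = n then
        real n / 2 * poly (legendre (n - 1)) (\<tau> n) * (1 / real k * quot_coeff n \<tau> n (k - 1))
      else
        real n / (2 * real k) *
          (poly (legendre (n - 1)) (\<tau> i) * quot_coeff n \<tau> i (k - 1)
           - poly (legendre (n - 1)) (\<tau> (i + 1)) * quot_coeff n \<tau> (i + 1) (k - 1)))"


section \<open>Algorithms over the reals\<close>

text \<open>
  The computational model consists of programs with \<open>for\<close>-loops that work on named arrays of real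
  numbers. A program is a finite object that does not depend on \<open>n\<close>, \<open>d\<close>, \<open>t\<close> or on any other
  input, and it contains no real constants.

  The cost of a run is the number of real additions, subtractions, multiplications and divisions
  executed. Index arithmetic and copying are not counted. A natural number read as a real number
  (\<open>Num\<close>) is not counted either; it can only be obtained from \<open>n\<close>, \<open>d\<close>, loop counters and integer
  literals by (truncated) addition and subtraction.
\<close>

datatype iexp = Const nat | Var string | Plus iexp iexp | Minus iexp iexp

datatype rop = Add | Sub | Mul | Div

datatype rexp = Get string "iexp list" | Num iexp | Op rop rexp rexp

datatype com =
    Skip
  | Assign string "iexp list" rexp
  | Seq com com  (infixr \<open>;;\<close> 60)
  | For string iexp iexp com

type_synonym env = "string \<Rightarrow> nat"
type_synonym mem = "string \<times> nat list \<Rightarrow> real"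

primrec ival :: "env \<Rightarrow> iexp \<Rightarrow> nat" where
  "ival \<nu> (Const c) = c"
| "ival \<nu> (Var x) = \<nu> x"
| "ival \<nu> (Plus a b) = ival \<nu> a + ival \<nu> b"
| "ival \<nu> (Minus a b) = ival \<nu> a - ival \<nu> b"

text \<open>Division by zero is a run-time error, represented by \<open>None\<close>.\<close>

fun apply_rop :: "rop \<Rightarrow> real \<Rightarrow> real \<Rightarrow> real option" where
  "apply_rop Add u v = Some (u + v)"
| "apply_rop Sub u v = Some (u - v)"
| "apply_rop Mul u v = Some (u * v)"
| "apply_rop Div u v = (if v = 0 then None else Some (u / v))"

primrec rval :: "env \<Rightarrow> mem \<Rightarrow> rexp \<Rightarrow> real option" where
  "rval \<nu> \<mu> (Get a js) = Some (\<mu> (a, map (ival \<nu>) js))"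
| "rval \<nu> \<mu> (Num e) = Some (real (ival \<nu> e))"
| "rval \<nu> \<mu> (Op f e1 e2) =
     Option.bind (rval \<nu> \<mu> e1) (\<lambda>u. Option.bind (rval \<nu> \<mu> e2) (apply_rop f u))"

primrec ops :: "rexp \<Rightarrow> nat" where
  "ops (Get a js) = 0"
| "ops (Num e) = 0"
| "ops (Op f e1 e2) = ops e1 + ops e2 + 1"

text \<open>\<open>exec c \<nu> (\<mu>, m) = Some (\<mu>', m')\<close>: in the memory \<open>\<mu>\<close> and with the values \<open>\<nu>\<close> of the size
  parameters and enclosing loop counters, \<open>c\<close> terminates without error in the memory \<open>\<mu>'\<close>, having
  executed \<open>m' - m\<close> arithmetic operations. The bounds of a loop are inclusive and are evaluated
  once, on entry.\<close>

primrec exec :: "com \<Rightarrow> env \<Rightarrow> mem \<times> nat \<Rightarrow> (mem \<times> nat) option" where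
  "exec Skip \<nu> \<sigma> = Some \<sigma>"
| "exec (Assign a js e) \<nu> \<sigma> =
     map_option (\<lambda>v. ((fst \<sigma>)((a, map (ival \<nu>) js) := v), snd \<sigma> + ops e)) (rval \<nu> (fst \<sigma>) e)"
| "exec (c1 ;; c2) \<nu> \<sigma> = Option.bind (exec c1 \<nu> \<sigma>) (exec c2 \<nu>)"
| "exec (For x lo hi c) \<nu> \<sigma> =
     fold (\<lambda>k r. Option.bind r (exec c (\<nu>(x := k)))) [ival \<nu> lo..<Suc (ival \<nu> hi)] (Some \<sigma>)"

text \<open>\<open>computes c \<nu> \<mu> N Q\<close>: from the initial memory \<open>\<mu>\<close>, \<open>c\<close> needs at most \<open>N\<close> arithmetic
  operations, and its final memory satisfies \<open>Q\<close>.\<close>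

definition computes :: "com \<Rightarrow> env \<Rightarrow> mem \<Rightarrow> nat \<Rightarrow> (mem \<Rightarrow> bool) \<Rightarrow> bool" where
  "computes c \<nu> \<mu> N Q \<longleftrightarrow> (\<exists>\<mu>' m. exec c \<nu> (\<mu>, 0) = Some (\<mu>', m) \<and> m \<le> N \<and> Q \<mu>')"

text \<open>The inputs of the evaluation: \<open>n\<close>, the zeros of \<open>P\<^sub>n\<close> in the array \<open>tau\<close>, and \<open>t\<close>. All other
  cells of the memory have arbitrary initial contents.\<close>

definition eval_input :: "nat \<Rightarrow> (nat \<Rightarrow> real) \<Rightarrow> real \<Rightarrow> env \<Rightarrow> mem \<Rightarrow> bool" where
  "eval_input n \<tau> t \<nu> \<mu> \<longleftrightarrow>
     \<nu> ''n'' = n \<and> (\<forall>i\<in>{1..n}. \<mu> (''tau'', [i]) = \<tau> i) \<and> \<mu> (''t'', []) = t"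

definition curve_input :: "nat \<Rightarrow> nat \<Rightarrow> (nat \<Rightarrow> nat \<Rightarrow> real) \<Rightarrow> env \<Rightarrow> mem \<Rightarrow> bool" where
  "curve_input n d W \<nu> \<mu> \<longleftrightarrow>
     \<nu> ''d'' = d \<and> (\<forall>i\<in>{0..n}. \<forall>j\<in>{1..d}. \<mu> (''W'', [i, j]) = W i j)"

text \<open>Horner's scheme in powers of \<open>y = t + 1\<close> for the \<open>n + 1\<close> polynomials of degree at most \<open>n\<close>
  whose coefficients are stored in the rows of the array \<open>A\<close>; the values are stored in \<open>F\<close>.\<close>

definition horner :: com where
  "horner =
     Assign ''y'' [] (Op Add (Get ''t'' []) (Num (Const 1))) ;;
     For ''i'' (Const 0) (Var ''n'') (
       Assign ''F'' [Var ''i''] (Get ''A'' [Var ''i'', Var ''n'']) ;;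
       For ''k'' (Const 1) (Var ''n'') (
         Assign ''F'' [Var ''i'']
           (Op Add (Op Mul (Get ''F'' [Var ''i'']) (Get ''y'' []))
                   (Get ''A'' [Var ''i'', Minus (Var ''n'') (Var ''k'')]))))"

text \<open>Component-wise evaluation of \<open>\<Sum>i\<le>n. W\<^sub>i F\<^sub>i\<close>; the coordinates are stored in \<open>X\<close>.\<close>

definition combine :: com where
  "combine =
     For ''j'' (Const 1) (Var ''d'') (
       Assign ''X'' [Var ''j'']
         (Op Mul (Get ''W'' [Const 0, Var ''j'']) (Get ''F'' [Const 0])) ;;
       For ''i'' (Const 1) (Var ''n'') (
         Assign ''X'' [Var ''j'']
           (Op Add (Get ''X'' [Var ''j''])
                   (Op Mul (Get ''W'' [Var ''i'', Var ''j'']) (Get ''F'' [Var ''i''])))))"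

end

theory Submission
  imports Defs
begin

text \<open>
  Integrating \<open>P\<^sub>n(x) / (x - \<tau>\<^sub>i)\<close>, which is a polynomial because \<open>\<tau>\<^sub>i\<close> is a zero of \<open>P\<^sub>n\<close>, term by
  term in powers of \<open>x + 1\<close> gives the coefficients of \<open>G\<^sub>i + 1/2\<close>, and no constant of integration
  appears because the integral starts at \<open>-1\<close>. If \<open>G\<^sub>0 + 1/2 = 1\<close> and \<open>G\<^bsub>n+1\<^esub> + 1/2 = 0\<close> are
  treated as polynomials of the same kind (\<open>gl_G_coeff\<close>), then the coefficients of all
  \<open>F\<^sub>i = G\<^sub>i - G\<^bsub>i+1\<^esub>\<close> are uniformly differences of neighbouring rows (\<open>gl_coeff_eq_diff\<close>), and the
  three representations are instances of \<open>gl_F_eq_sum\<close>.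

  Everything is computed in quadratic time since each quantity takes a bounded number of operations
  once its predecessors are known. Bonnet's recurrence for \<open>P\<^sub>m\<close>, written in the variable
  \<open>y = x + 1\<close>, links single coefficients of \<open>P\<^sub>m\<close>, \<open>P\<^bsub>m-1\<^esub>\<close> and \<open>P\<^bsub>m-2\<^esub>\<close>, so
  the triangle of coefficients up to \<open>P\<^sub>n\<close> costs \<open>O(n\<^sup>2)\<close>. The same recurrence at the points \<open>\<tau>\<^sub>i\<close>
  gives the values \<open>P\<^bsub>n-1\<^esub>(\<tau>\<^sub>i)\<close>. Synthetic division of \<open>P\<^sub>n\<close> by \<open>y - (\<tau>\<^sub>i + 1)\<close> takes \<open>O(n)\<close>
  operations and returns \<open>b\<^sup>(\<^sup>i\<^sup>)\<^sub>0, \<dots>, b\<^sup>(\<^sup>i\<^sup>)\<^bsub>n-1\<^esub>\<close>. A Hoare-style calculus for \<open>computes\<close>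
  (\<open>computes_Seq\<close>, \<open>computes_For\<close>) verifies values and costs at the same time.
\<close>

section \<open>Coefficients in powers of x + 1\<close>

text \<open>For \<open>k = 1\<close> the truncated index \<open>k - 2\<close> is \<open>0\<close>, but the factor \<open>k - 1\<close> vanishes. Hence one
  formula, and later one loop body, covers all \<open>k \<ge> 1\<close>.\<close>

lemma legendre_rec:
  assumes "k \<ge> 1"
  shows "legendre k = smult (1 / real k)
    (smult (real (2 * k - 1)) ([:0, 1:] * legendre (k - 1)) - smult (real (k - 1)) (legendre (k - 2)))"
proof (cases "k = 1")
  case True
  then show ?thesis by simp
next
  case False
  then obtain j where "k = Suc (Suc j)"
    using assms by (cases k rule: legendre.cases) auto
  then show ?thesis by (simp add: numeral_3_eq_3)
qed

text \<open>The polynomial \<open>P\<^sub>m(y - 1)\<close>: its coefficients are those of \<open>P\<^sub>m\<close> in powers of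
  \<open>y = x + 1\<close>.\<close>

definition legendre_at_m1 :: "nat \<Rightarrow> real poly" where
  "legendre_at_m1 m = pcompose (legendre m) [:-1, 1:]"

lemma poly_legendre_at_m1: "poly (legendre_at_m1 m) (x + 1) = poly (legendre m) x"
  by (simp add: legendre_at_m1_def poly_pcompose)

lemma legendre_at_m1_0 [simp]: "legendre_at_m1 0 = 1"
  by (simp add: legendre_at_m1_def pcompose_1)

lemma legendre_at_m1_rec:
  assumes "k \<ge> 1"
  shows "legendre_at_m1 k = smult (1 / real k)
    (smult (real (2 * k - 1)) (pCons 0 (legendre_at_m1 (k - 1)) - legendre_at_m1 (k - 1))
     - smult (real (k - 1)) (legendre_at_m1 (k - 2)))"
  unfolding legendre_at_m1_def
  by (subst legendre_rec[OF assms])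
     (simp add: pcompose_diff pcompose_smult pcompose_mult pcompose_pCons)

lemma degree_legendre_at_m1: "degree (legendre_at_m1 m) \<le> m"
proof (induction m rule: less_induct)
  case (less m)
  show ?case
  proof (cases "m = 0")
    case False
    have "degree (legendre_at_m1 (m - 1)) \<le> m - 1" "degree (legendre_at_m1 (m - 2)) \<le> m"
      using less[of "m - 1"] less[of "m - 2"] False by auto
    then show ?thesis
      using False
      by (subst legendre_at_m1_rec)
         (auto intro!: degree_diff_le order.trans[OF degree_smult_le]
            order.trans[OF degree_pCons_le])
  qed simp
qed

text \<open>In the variable \<open>y = x + 1\<close> the zero \<open>r\<close> of \<open>P\<^sub>n\<close> becomes \<open>r + 1\<close>, and the division leaves no
  remainder.\<close>

definition legendre_quotient :: "nat \<Rightarrow> real \<Rightarrow> real poly" where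
  "legendre_quotient n r = synthetic_div (legendre_at_m1 n) (r + 1)"

lemma coeff_legendre_quotient_ge:
  assumes "k \<ge> n" "n \<ge> 1"
  shows "coeff (legendre_quotient n r) k = 0"
proof (cases "degree (legendre_at_m1 n) = 0")
  case True
  then have "legendre_quotient n r = 0"
    by (simp only: legendre_quotient_def synthetic_div_eq_0_iff)
  then show ?thesis by simp
next
  case False
  then show ?thesis
    using degree_legendre_at_m1[of n] assms
    by (intro coeff_eq_0) (simp add: legendre_quotient_def degree_synthetic_div)
qed

lemma legendre_quotient_mult:
  assumes "poly (legendre n) r = 0"
  shows "[:- (r + 1), 1:] * legendre_quotient n r = legendre_at_m1 n"
  using synthetic_div_correct'[of "r + 1" "legendre_at_m1 n"] assms
  by (simp add: legendre_quotient_def poly_legendre_at_m1)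

text \<open>Comparing coefficients in \<open>(y - (r + 1)) q = P\<^sub>n\<close>. Read downwards from \<open>k = n - 1\<close>, this
  computes the quotient with two operations per coefficient.\<close>

lemma coeff_legendre_quotient_rec:
  assumes "poly (legendre n) r = 0"
  shows "coeff (legendre_quotient n r) k =
    coeff (legendre_at_m1 n) (Suc k) + (r + 1) * coeff (legendre_quotient n r) (Suc k)"
  by (subst legendre_quotient_mult[OF assms, symmetric]) (simp add: algebra_simps)

lemma poly_eq_sum_lessThan:
  fixes p :: "real poly"
  assumes "\<And>k. k \<ge> n \<Longrightarrow> coeff p k = 0"
  shows "poly p x = (\<Sum>k<n. coeff p k * x ^ k)"
proof -
  have "poly p x = (\<Sum>k\<le>degree p. coeff p k * x ^ k)"
    by (rule poly_altdef)
  also have "\<dots> = (\<Sum>k\<in>{..degree p} \<union> {..<n}. coeff p k * x ^ k)"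
    by (rule sum.mono_neutral_left) (auto intro: coeff_eq_0)
  also have "\<dots> = (\<Sum>k<n. coeff p k * x ^ k)"
    by (rule sum.mono_neutral_right) (use assms in auto)
  finally show ?thesis .
qed

lemma legendre_quotient_eq:
  assumes "poly (legendre n) r = 0" "n \<ge> 1" "x \<noteq> r"
  shows "poly (legendre n) x / (x - r) = (\<Sum>k<n. coeff (legendre_quotient n r) k * (x + 1) ^ k)"
proof -
  have "poly (legendre n) x = (x - r) * poly (legendre_quotient n r) (x + 1)"
    unfolding poly_legendre_at_m1[symmetric] legendre_quotient_mult[OF assms(1), symmetric]
    by (simp add: algebra_simps)
  then show ?thesis
    using assms poly_eq_sum_lessThan[of n "legendre_quotient n r" "x + 1"]
    by (simp add: coeff_legendre_quotient_ge)
qed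

text \<open>The difference of the two sides is a polynomial that vanishes at infinitely many points. One
  point has to be left out because \<open>quot_coeff\<close> constrains the quotient only away from \<open>\<tau>\<^sub>i\<close>.\<close>

lemma polyfun_coeffs_unique_off_point:
  fixes a b :: "nat \<Rightarrow> real"
  assumes "\<And>y. y \<noteq> s \<Longrightarrow> (\<Sum>k<n. a k * y ^ k) = (\<Sum>k<n. b k * y ^ k)" "k < n"
  shows "a k = b k"
proof -
  define p where "p = (\<Sum>k<n. monom (a k - b k) k)"
  have "poly p y = 0" if "y \<noteq> s" for y
    using assms(1)[OF that]
    by (simp add: p_def poly_sum poly_monom left_diff_distrib sum_subtractf)
  then have "UNIV - {s} \<subseteq> {y. poly p y = 0}" by auto
  then have "infinite {y. poly p y = 0}"
    using infinite_UNIV_char_0[where 'a = real] finite_subset by fastforce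
  then have "p = 0" using poly_roots_finite by blast
  moreover have "coeff p k = a k - b k"
    using assms(2) by (simp add: p_def coeff_sum)
  ultimately show ?thesis by simp
qed

text \<open>The quotient by synthetic division satisfies the description in \<open>quot_coeff\<close>, and uniqueness
  makes the description definite.\<close>

lemma quot_coeff_eq:
  assumes "poly (legendre n) (\<tau> i) = 0" "n \<ge> 1"
  shows "quot_coeff n \<tau> i = coeff (legendre_quotient n (\<tau> i))"
  unfolding quot_coeff_def
proof (rule the_equality)
  show "(\<forall>x. x \<noteq> \<tau> i \<longrightarrow> poly (legendre n) x / (x - \<tau> i) =
      (\<Sum>k<n. coeff (legendre_quotient n (\<tau> i)) k * (x + 1) ^ k)) \<and>
    (\<forall>k\<ge>n. coeff (legendre_quotient n (\<tau> i)) k = 0)"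
    using assms by (simp add: legendre_quotient_eq coeff_legendre_quotient_ge)
next
  fix b
  assume b: "(\<forall>x. x \<noteq> \<tau> i \<longrightarrow> poly (legendre n) x / (x - \<tau> i) = (\<Sum>k<n. b k * (x + 1) ^ k)) \<and>
    (\<forall>k\<ge>n. b k = 0)"
  show "b = coeff (legendre_quotient n (\<tau> i))"
  proof
    fix k
    show "b k = coeff (legendre_quotient n (\<tau> i)) k"
    proof (cases "k < n")
      case True
      have "(\<Sum>k<n. b k * y ^ k) = (\<Sum>k<n. coeff (legendre_quotient n (\<tau> i)) k * y ^ k)"
        if "y \<noteq> \<tau> i + 1" for y
        using b legendre_quotient_eq[OF assms, of "y - 1"] that by (auto dest: spec[of _ "y - 1"])
      then show ?thesis using True by (rule polyfun_coeffs_unique_off_point)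
    qed (use b assms in \<open>auto simp: coeff_legendre_quotient_ge\<close>)
  qed
qed

text \<open>The integrand agrees with a polynomial except at the single point \<open>r\<close>, so the fundamental
  theorem of calculus applies to the explicit primitive, which vanishes at \<open>-1\<close>.\<close>

lemma integral_legendre_quotient:
  assumes "poly (legendre n) r = 0" "n \<ge> 1" "t \<ge> -1"
  shows "integral {-1..t} (\<lambda>x. poly (legendre n) x / (x - r)) =
    (\<Sum>k=1..n. 1 / real k * coeff (legendre_quotient n r) (k - 1) * (t + 1) ^ k)"
proof -
  let ?b = "coeff (legendre_quotient n r)"
  define H where "H = (\<lambda>x. \<Sum>k<n. ?b k / real (Suc k) * (x + 1) ^ Suc k)"
  have "(H has_vector_derivative (\<Sum>k<n. ?b k * (x + 1) ^ k)) (at x within {-1..t})" for x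
    unfolding H_def has_real_derivative_iff_has_vector_derivative[symmetric]
    by (auto intro!: derivative_eq_intros sum.cong simp del: of_nat_Suc power_Suc)
  then have "((\<lambda>x. \<Sum>k<n. ?b k * (x + 1) ^ k) has_integral (H t - H (-1))) {-1..t}"
    using assms(3) by (intro fundamental_theorem_of_calculus) auto
  then have "((\<lambda>x. poly (legendre n) x / (x - r)) has_integral (H t - H (-1))) {-1..t}"
    by (rule has_integral_spike[of "{r}", rotated 2])
       (use assms in \<open>auto simp: legendre_quotient_eq\<close>)
  moreover have "H (-1) = 0" by (simp add: H_def)
  moreover have "H t = (\<Sum>k=1..n. 1 / real k * ?b (k - 1) * (t + 1) ^ k)"
    unfolding H_def
    by (rule sum.reindex_bij_witness[of _ "\<lambda>k. k - 1" Suc]) auto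
  ultimately show ?thesis by (simp add: integral_unique)
qed

text \<open>The coefficients of \<open>G\<^sub>i(t) + 1/2\<close> in powers of \<open>t + 1\<close> for \<open>0 \<le> i \<le> n + 1\<close>. The shift by
  \<open>1/2\<close> cancels in the differences \<open>F\<^sub>i\<close> and makes all constant terms vanish except for \<open>i = 0\<close>.\<close>

definition gl_G_coeff :: "nat \<Rightarrow> (nat \<Rightarrow> real) \<Rightarrow> nat \<Rightarrow> nat \<Rightarrow> real" where
  "gl_G_coeff n \<tau> i k =
     (if k = 0 then (if i = 0 then 1 else 0)
      else if i \<in> {1..n} then
        real n / 2 * poly (legendre (n - 1)) (\<tau> i) * (1 / real k * quot_coeff n \<tau> i (k - 1))
      else 0)"

lemma legendre_zeros_root:
  "legendre_zeros n \<tau> \<Longrightarrow> i \<in> {1..n} \<Longrightarrow> poly (legendre n) (\<tau> i) = 0"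
  by (auto simp: legendre_zeros_def)

lemma sum_atMost_split_0:
  fixes f :: "nat \<Rightarrow> real"
  shows "(\<Sum>k\<le>n. f k) = f 0 + (\<Sum>k=1..n. f k)"
  by (simp add: atMost_atLeast0 sum.atLeast_Suc_atMost)

lemma gl_G_eq_sum:
  assumes "legendre_zeros n \<tau>" "n \<ge> 1" "t \<ge> -1" "i \<le> n + 1"
  shows "gl_G n \<tau> i t = (\<Sum>k\<le>n. gl_G_coeff n \<tau> i k * (t + 1) ^ k) - 1 / 2"
proof (cases "i \<in> {1..n}")
  case True
  note root = legendre_zeros_root[OF assms(1) True]
  show ?thesis
    using True assms(2,3) root
    by (simp add: gl_G_def gl_G_coeff_def sum_atMost_split_0 integral_legendre_quotient
        quot_coeff_eq sum_distrib_left mult.assoc)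
next
  case False
  then have "i = 0 \<or> i = n + 1" using assms(4) by auto
  then show ?thesis
    by (auto simp: gl_G_def gl_G_coeff_def sum_atMost_split_0)
qed

text \<open>The rows \<open>0\<close> and \<open>n + 1\<close> of \<open>gl_G_coeff\<close> vanish for \<open>k \<ge> 1\<close>. This is why the three cases of
  \<open>gl_coeff\<close> need no separate treatment.\<close>

lemma gl_coeff_eq_diff:
  assumes "n \<ge> 1" "i \<le> n"
  shows "gl_coeff n \<tau> i k = gl_G_coeff n \<tau> i k - gl_G_coeff n \<tau> (i + 1) k"
  using assms by (cases "i = 0") (auto simp: gl_coeff_def gl_G_coeff_def field_simps)

lemma gl_F_eq_sum:
  assumes "legendre_zeros n \<tau>" "n \<ge> 1" "t \<ge> -1" "i \<le> n"
  shows "gl_F n \<tau> i t = (\<Sum>k\<le>n. gl_coeff n \<tau> i k * (t + 1) ^ k)"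
  using assms
  by (simp add: gl_F_def gl_G_eq_sum gl_coeff_eq_diff left_diff_distrib sum_subtractf)

lemma gl_F_representation:
  assumes "legendre_zeros n \<tau>" "n \<ge> 1" "t \<ge> -1"
  shows "i \<in> {1..n-1} \<Longrightarrow> gl_F n \<tau> i t =
            (\<Sum>k=1..n. real n / (2 * real k) *
               (poly (legendre (n-1)) (\<tau> i) * quot_coeff n \<tau> i (k-1)
                - poly (legendre (n-1)) (\<tau> (i+1)) * quot_coeff n \<tau> (i+1) (k-1)) * (t+1)^k)"
    and "gl_F n \<tau> 0 t =
           1 - real n / 2 * poly (legendre (n-1)) (\<tau> 1) *
                 (\<Sum>k=1..n. 1 / real k * quot_coeff n \<tau> 1 (k-1) * (t+1)^k)"
    and "gl_F n \<tau> n t =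
           real n / 2 * poly (legendre (n-1)) (\<tau> n) *
                 (\<Sum>k=1..n. 1 / real k * quot_coeff n \<tau> n (k-1) * (t+1)^k)"
proof -
  have F: "gl_F n \<tau> i t = gl_coeff n \<tau> i 0 + (\<Sum>k=1..n. gl_coeff n \<tau> i k * (t + 1) ^ k)"
    if "i \<le> n" for i
    using gl_F_eq_sum[OF assms that] by (simp add: sum_atMost_split_0)
  show "gl_F n \<tau> i t =
            (\<Sum>k=1..n. real n / (2 * real k) *
               (poly (legendre (n-1)) (\<tau> i) * quot_coeff n \<tau> i (k-1)
                - poly (legendre (n-1)) (\<tau> (i+1)) * quot_coeff n \<tau> (i+1) (k-1)) * (t+1)^k)"
    if "i \<in> {1..n-1}"
  proof -
    have "gl_coeff n \<tau> i 0 = 0" and "i \<le> n"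
      using that by (auto simp: gl_coeff_def)
    then show ?thesis
      unfolding F[OF \<open>i \<le> n\<close>] using that
      by (simp only: add_0_left, intro sum.cong) (auto simp: gl_coeff_def)
  qed
  have "(\<Sum>k=1..n. gl_coeff n \<tau> 0 k * (t + 1) ^ k) =
      (\<Sum>k=1..n. - (real n / 2 * poly (legendre (n-1)) (\<tau> 1) *
                 (1 / real k * quot_coeff n \<tau> 1 (k-1) * (t+1)^k)))"
    by (intro sum.cong) (auto simp: gl_coeff_def)
  then show "gl_F n \<tau> 0 t =
           1 - real n / 2 * poly (legendre (n-1)) (\<tau> 1) *
                 (\<Sum>k=1..n. 1 / real k * quot_coeff n \<tau> 1 (k-1) * (t+1)^k)"
    unfolding F[OF le0] by (simp only: sum_negf sum_distrib_left) (simp add: gl_coeff_def)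
  have "(\<Sum>k=1..n. gl_coeff n \<tau> n k * (t + 1) ^ k) =
      (\<Sum>k=1..n. real n / 2 * poly (legendre (n-1)) (\<tau> n) *
                 (1 / real k * quot_coeff n \<tau> n (k-1) * (t+1)^k))"
    using assms(2) by (intro sum.cong) (auto simp: gl_coeff_def)
  then show "gl_F n \<tau> n t =
           real n / 2 * poly (legendre (n-1)) (\<tau> n) *
                 (\<Sum>k=1..n. 1 / real k * quot_coeff n \<tau> n (k-1) * (t+1)^k)"
    unfolding F[OF order.refl] using assms(2)
    by (simp only: sum_distrib_left) (simp add: gl_coeff_def)
qed

section \<open>Reasoning about programs\<close>

lemma fold_bind_None [simp]: "fold (\<lambda>k r. Option.bind r (f k)) xs None = None"
  by (induction xs) auto

text \<open>The operation counter never influences a run. Therefore costs measured from zero, as in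
  \<open>computes\<close>, can be added up.\<close>

lemma exec_shift_cost:
  "exec c \<nu> (\<mu>, m) = Some (\<mu>', m') \<Longrightarrow> exec c \<nu> (\<mu>, a + m) = Some (\<mu>', a + m')"
proof (induction c arbitrary: \<nu> \<mu> m \<mu>' m')
  case (Seq c1 c2)
  then show ?case by (force simp: Option.bind_eq_Some_conv)
next
  case (For x lo hi c)
  let ?F = "fold (\<lambda>k r. Option.bind r (exec c (\<nu>(x := k))))"
  have "?F xs (Some (\<mu>, m)) = Some (\<mu>', m') \<Longrightarrow> ?F xs (Some (\<mu>, a + m)) = Some (\<mu>', a + m')"
    for xs
  proof (induction xs arbitrary: \<mu> m)
    case (Cons k xs)
    show ?case
    proof (cases "exec c (\<nu>(x := k)) (\<mu>, m)")
      case (Some \<sigma>)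
      then show ?thesis
        using Cons For.IH by (cases \<sigma>) (auto simp del: fun_upd_apply)
    qed (use Cons.prems in \<open>simp del: fun_upd_apply\<close>)
  qed simp
  then show ?case using For.prems by simp
qed auto

text \<open>The names of the arrays that a program assigns to. All other arrays keep their contents, and
  invariants need not mention them.\<close>

primrec written :: "com \<Rightarrow> string set" where
  "written Skip = {}"
| "written (Assign a js e) = {a}"
| "written (c1 ;; c2) = written c1 \<union> written c2"
| "written (For x lo hi c) = written c"

lemma exec_not_written:
  "exec c \<nu> \<sigma> = Some \<sigma>' \<Longrightarrow> a \<notin> written c \<Longrightarrow> fst \<sigma>' (a, js) = fst \<sigma> (a, js)"
proof (induction c arbitrary: \<nu> \<sigma> \<sigma>')
  case (Seq c1 c2)
  then obtain \<sigma>1 where "exec c1 \<nu> \<sigma> = Some \<sigma>1" "exec c2 \<nu> \<sigma>1 = Some \<sigma>'"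
    by (auto simp: Option.bind_eq_Some_conv)
  then show ?case using Seq.IH Seq.prems(2) by simp
next
  case (For x lo hi c)
  let ?F = "fold (\<lambda>k r. Option.bind r (exec c (\<nu>(x := k))))"
  have "?F xs (Some \<sigma>) = Some \<sigma>' \<Longrightarrow> fst \<sigma>' (a, js) = fst \<sigma> (a, js)" for xs
  proof (induction xs arbitrary: \<sigma>)
    case (Cons k xs)
    show ?case
    proof (cases "exec c (\<nu>(x := k)) \<sigma>")
      case (Some \<sigma>1)
      then show ?thesis
        using Cons For.IH[OF Some] For.prems(2) by (simp del: fun_upd_apply)
    qed (use Cons.prems in \<open>simp del: fun_upd_apply\<close>)
  qed simp
  then show ?case using For.prems by simp
qed auto

text \<open>Weakening of the postcondition and of the cost bound, with the contents of the arrays that are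
  not assigned to as additional knowledge.\<close>

lemma computes_frame:
  assumes "computes c \<nu> \<mu> N Q"
    and "\<And>\<mu>'. Q \<mu>' \<Longrightarrow> (\<And>a js. a \<notin> written c \<Longrightarrow> \<mu>' (a, js) = \<mu> (a, js)) \<Longrightarrow> R \<mu>'"
    and "N \<le> M"
  shows "computes c \<nu> \<mu> M R"
proof -
  obtain \<mu>' m where run: "exec c \<nu> (\<mu>, 0) = Some (\<mu>', m)" "m \<le> N" "Q \<mu>'"
    using assms(1) unfolding computes_def by blast
  have "R \<mu>'"
    using exec_not_written[OF run(1)] by (intro assms(2) run(3)) simp
  then show ?thesis using run assms(3) by (auto simp: computes_def)
qed

lemma computes_Assign:
  assumes "rval \<nu> \<mu> e = Some v" "Q (\<mu>((a, map (ival \<nu>) js) := v))" "ops e \<le> N"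
  shows "computes (Assign a js e) \<nu> \<mu> N Q"
  using assms by (simp add: computes_def)

lemma computes_Seq:
  assumes "computes c1 \<nu> \<mu> Na R" 
    "\<And>\<mu>'. R \<mu>' \<Longrightarrow> (\<And>a js. a \<notin> written c1 \<Longrightarrow> \<mu>' (a, js) = \<mu> (a, js)) \<Longrightarrow>
       computes c2 \<nu> \<mu>' Nb Q"
    "Na + Nb \<le> N"
  shows "computes (c1 ;; c2) \<nu> \<mu> N Q"
proof -
  obtain \<mu>1 m1 where 1: "exec c1 \<nu> (\<mu>, 0) = Some (\<mu>1, m1)" "m1 \<le> Na" "R \<mu>1"
    using assms(1) unfolding computes_def by blast
  obtain \<mu>2 m2 where 2: "exec c2 \<nu> (\<mu>1, 0) = Some (\<mu>2, m2)" "m2 \<le> Nb" "Q \<mu>2"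
    using assms(2)[OF 1(3)] exec_not_written[OF 1(1)] unfolding computes_def by auto
  have "exec c2 \<nu> (\<mu>1, m1) = Some (\<mu>2, m1 + m2)"
    using exec_shift_cost[OF 2(1), of m1] by simp
  then show ?thesis using 1 2 assms(3) by (simp add: computes_def)
qed

text \<open>The loop rule: \<open>I k\<close> is the invariant before the iteration with counter \<open>k\<close>, and \<open>N\<close> bounds the
  cost of every iteration. The third premise allows an empty loop, but only with \<open>lo = hi + 1\<close>, so
  that \<open>I (hi + 1)\<close> is the invariant on exit in every case.\<close>

lemma computes_For:
  assumes "I (ival \<nu> lo) \<mu>"
    and "\<And>k \<mu>'. ival \<nu> lo \<le> k \<Longrightarrow> k \<le> ival \<nu> hi \<Longrightarrow> I k \<mu>' \<Longrightarrow>
           (\<And>a js. a \<notin> written c \<Longrightarrow> \<mu>' (a, js) = \<mu> (a, js)) \<Longrightarrow>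
           computes c (\<nu>(x := k)) \<mu>' N (I (Suc k))"
    and "ival \<nu> lo \<le> Suc (ival \<nu> hi)"
    and "(Suc (ival \<nu> hi) - ival \<nu> lo) * N \<le> M"
    and "\<And>\<mu>'. I (Suc (ival \<nu> hi)) \<mu>' \<Longrightarrow> Q \<mu>'"
  shows "computes (For x lo hi c) \<nu> \<mu> M Q"
proof -
  let ?F = "fold (\<lambda>k r. Option.bind r (exec c (\<nu>(x := k))))"
  let ?l = "ival \<nu> lo"
  \<comment> \<open>The frame property refers to the memory on entry and is itself carried through the loop.\<close>
  let ?J = "\<lambda>k \<mu>'. I k \<mu>' \<and> (\<forall>a js. a \<notin> written c \<longrightarrow> \<mu>' (a, js) = \<mu> (a, js))"
  have body: "computes c (\<nu>(x := k)) \<mu>' N (?J (Suc k))"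
    if "?l \<le> k" "k \<le> ival \<nu> hi" "?J k \<mu>'" for k \<mu>'
    by (rule computes_frame[OF assms(2)[of k \<mu>']]) (use that in auto)
  have "\<exists>\<mu>' m. ?F [?l..<?l + j] (Some (\<mu>, 0)) = Some (\<mu>', m) \<and> m \<le> j * N \<and> ?J (?l + j) \<mu>'"
    if "?l + j \<le> Suc (ival \<nu> hi)" for j
    using that
  proof (induction j)
    case 0
    then show ?case using assms(1) by simp
  next
    case (Suc j)
    then obtain \<mu>1 m1 where 1: "?F [?l..<?l + j] (Some (\<mu>, 0)) = Some (\<mu>1, m1)" "m1 \<le> j * N"
        "?J (?l + j) \<mu>1"
      by (metis Suc_leD add_Suc_right)
    then obtain \<mu>2 m2 where 2: "exec c (\<nu>(x := ?l + j)) (\<mu>1, 0) = Some (\<mu>2, m2)" "m2 \<le> N"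
        "?J (Suc (?l + j)) \<mu>2"
      using body[of "?l + j" \<mu>1] Suc.prems unfolding computes_def by auto
    have "exec c (\<nu>(x := ?l + j)) (\<mu>1, m1) = Some (\<mu>2, m1 + m2)"
      using exec_shift_cost[OF 2(1), of m1] by simp
    then show ?case using 1 2 by (simp del: fun_upd_apply)
  qed
  from this[of "Suc (ival \<nu> hi) - ?l"] show ?thesis
    using assms(3-5) by (auto simp: computes_def simp del: upt_Suc intro: order.trans)
qed

section \<open>Computing the coefficients\<close>

text \<open>The column index is one larger than the exponent. Column \<open>0\<close> contains zeros and plays the role of
  the missing coefficient of \<open>y\<^bsup>-1\<^esup>\<close> when the recurrence multiplies by \<open>y\<close>.\<close>

definition legendre_entry :: "nat \<Rightarrow> nat \<Rightarrow> real" where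
  "legendre_entry m j = coeff (pCons 0 (legendre_at_m1 m)) j"

lemma legendre_entry_0: "legendre_entry 0 j = (if j = 1 then 1 else 0)"
  by (auto simp: legendre_entry_def coeff_pCons split: nat.split)

lemma legendre_entry_col_0 [simp]: "legendre_entry m 0 = 0"
  by (simp add: legendre_entry_def)

lemma legendre_entry_rec:
  assumes "m \<ge> 1" "j \<ge> 1"
  shows "legendre_entry m j =
    (real (m + m - 1) * (legendre_entry (m - 1) (j - 1) - legendre_entry (m - 1) j)
     - real (m - 1) * legendre_entry (m - 2) j) / real m"
proof -
  obtain l where l: "j = Suc l" using assms(2) by (cases j) auto
  show ?thesis
    unfolding legendre_entry_def l
    by (subst legendre_at_m1_rec[OF assms(1)]) (simp flip: mult_2)
qed

text \<open>Row \<open>m \<ge> 1\<close> of the table of coefficients, by \<open>legendre_entry_rec\<close>. The columns run up to \<open>n + 1\<close>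
  because of the shift of the column index.\<close>

definition legendre_row :: com where
  "legendre_row =
     Assign ''L'' [Var ''m'', Const 0] (Num (Const 0)) ;;
     For ''j'' (Const 1) (Plus (Var ''n'') (Const 1)) (
       Assign ''L'' [Var ''m'', Var ''j'']
         (Op Div
           (Op Sub
             (Op Mul (Num (Minus (Plus (Var ''m'') (Var ''m'')) (Const 1)))
               (Op Sub
                 (Get ''L'' [Minus (Var ''m'') (Const 1), Minus (Var ''j'') (Const 1)])
                 (Get ''L'' [Minus (Var ''m'') (Const 1), Var ''j''])))
             (Op Mul (Num (Minus (Var ''m'') (Const 1)))
               (Get ''L'' [Minus (Var ''m'') (Const 2), Var ''j''])))
           (Num (Var ''m''))))"

definition legendre_table :: com where
  "legendre_table =
     For ''j'' (Const 0) (Plus (Var ''n'') (Const 1)) (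
       Assign ''L'' [Const 0, Var ''j''] (Num (Const 0))) ;;
     Assign ''L'' [Const 0, Const 1] (Num (Const 1)) ;;
     For ''m'' (Const 1) (Var ''n'') legendre_row"

lemma computes_legendre_row:
  assumes env: "\<nu> ''n'' = n" "\<nu> ''m'' = m" and m: "m \<ge> 1"
    and rows: "\<forall>m'<m. \<forall>j\<le>Suc n. \<mu> (''L'', [m', j]) = legendre_entry m' j"
  shows "computes legendre_row \<nu> \<mu> (5 * Suc n)
    (\<lambda>\<mu>'. \<forall>m'<Suc m. \<forall>j\<le>Suc n. \<mu>' (''L'', [m', j]) = legendre_entry m' j)"
proof -
  let ?J = "\<lambda>j \<mu>'. (\<forall>m'<m. \<forall>j\<le>Suc n. \<mu>' (''L'', [m', j]) = legendre_entry m' j) \<and>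
    (\<forall>j'<j. \<mu>' (''L'', [m, j']) = legendre_entry m j')"
  show ?thesis
    unfolding legendre_row_def
  proof (rule computes_Seq[where R = "?J 1" and Na = 0 and Nb = "5 * Suc n"], goal_cases)
    case 1
    show ?case using rows by (intro computes_Assign) (auto simp: env)
  next
    case (2 \<mu>')
    show ?case
    proof (rule computes_For[where I = ?J and N = 5], goal_cases)
      case (2 j \<mu>')
      then have "j \<ge> 1" "j \<le> Suc n" by (auto simp: env)
      then show ?case
        using 2 m legendre_entry_rec[of m j]
        by (intro computes_Assign[where v = "legendre_entry m j"]) (auto simp: env less_Suc_eq)
    next
      case (5 \<mu>'')
      show ?case
      proof (intro allI impI)
        fix m' j assume "m' < Suc m" "j \<le> Suc n"
        then show "\<mu>'' (''L'', [m', j]) = legendre_entry m' j"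
          using 5 by (cases "m' = m") (auto simp: env)
      qed
    qed (use 2 in \<open>auto simp: env\<close>)
  qed simp
qed

lemma computes_legendre_table:
  assumes n: "\<nu> ''n'' = n" "n \<ge> 1"
  shows "computes legendre_table \<nu> \<mu> (10 * n^2)
    (\<lambda>\<mu>'. \<forall>m\<le>n. \<forall>j\<le>Suc n. \<mu>' (''L'', [m, j]) = legendre_entry m j)"
proof -
  let ?I = "\<lambda>m \<mu>'. \<forall>m'<m. \<forall>j\<le>Suc n. \<mu>' (''L'', [m', j]) = legendre_entry m' j"
  have cost: "n * (5 * Suc n) \<le> 10 * n^2"
    using n(2) by (simp add: power2_eq_square)
  show ?thesis
    unfolding legendre_table_def
  proof (rule computes_Seq[where R = "\<lambda>\<mu>'. \<forall>j\<le>Suc n. \<mu>' (''L'', [0, j]) = 0"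
        and Na = 0 and Nb = "10 * n^2"], goal_cases)
    case 1
    show ?case
    proof (rule computes_For[where N = 0 and I = "\<lambda>k \<mu>'. \<forall>j<k. \<mu>' (''L'', [0, j]) = 0"], goal_cases)
      case (2 j \<mu>')
      then show ?case by (intro computes_Assign) (auto simp: less_Suc_eq)
    qed (auto simp: n less_Suc_eq_le)
  next
    case (2 \<mu>')
    show ?case
    proof (rule computes_Seq[where R = "?I 1" and Na = 0 and Nb = "10 * n^2"], goal_cases)
      case 1
      show ?case using 2 by (intro computes_Assign) (auto simp: legendre_entry_0)
    next
      case (2 \<mu>')
      show ?case
      proof (rule computes_For[where I = ?I and N = "5 * Suc n"], goal_cases)
        case (2 m \<mu>')
        then show ?case by (intro computes_legendre_row) (auto simp: n)
      qed (use 2 cost in \<open>auto simp: n less_Suc_eq_le\<close>)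
    qed simp
  qed simp
qed

definition legendre_values :: com where
  "legendre_values =
     For ''i'' (Const 1) (Var ''n'') (
       Assign ''P'' [Var ''i'', Const 0] (Num (Const 1)) ;;
       For ''m'' (Const 1) (Var ''n'') (
         Assign ''P'' [Var ''i'', Var ''m'']
           (Op Div
             (Op Sub
               (Op Mul (Num (Minus (Plus (Var ''m'') (Var ''m'')) (Const 1)))
                 (Op Mul (Get ''tau'' [Var ''i''])
                   (Get ''P'' [Var ''i'', Minus (Var ''m'') (Const 1)])))
               (Op Mul (Num (Minus (Var ''m'') (Const 1)))
                 (Get ''P'' [Var ''i'', Minus (Var ''m'') (Const 2)])))
             (Num (Var ''m'')))))"

lemma poly_legendre_rec:
  assumes "m \<ge> 1"
  shows "poly (legendre m) x =
    (real (m + m - 1) * (x * poly (legendre (m - 1)) x)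
     - real (m - 1) * poly (legendre (m - 2)) x) / real m"
  by (subst legendre_rec[OF assms]) (simp flip: mult_2)

lemma computes_legendre_values:
  assumes n: "\<nu> ''n'' = n" and tau: "\<forall>i\<in>{1..n}. \<mu> (''tau'', [i]) = \<tau> i"
  shows "computes legendre_values \<nu> \<mu> (5 * n^2)
    (\<lambda>\<mu>'. \<forall>i\<in>{1..n}. \<forall>m\<le>n. \<mu>' (''P'', [i, m]) = poly (legendre m) (\<tau> i))"
proof -
  let ?I = "\<lambda>i \<mu>'. \<forall>i'\<in>{1..<i}. \<forall>m\<le>n. \<mu>' (''P'', [i', m]) = poly (legendre m) (\<tau> i')"
  let ?J = "\<lambda>i m \<mu>'. ?I i \<mu>' \<and> (\<forall>m'<m. \<mu>' (''P'', [i, m']) = poly (legendre m') (\<tau> i))"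
  show ?thesis
    unfolding legendre_values_def
  proof (rule computes_For[where I = ?I and N = "5 * n"], goal_cases)
    case (2 i \<mu>')
    then have i: "i \<in> {1..n}" and \<tau>: "\<mu>' (''tau'', [i]) = \<tau> i" and I: "?I i \<mu>'"
      using tau by (auto simp: n)
    show ?case
    proof (rule computes_Seq[where R = "?J i 1" and Na = 0 and Nb = "5 * n"], goal_cases)
      case 1
      show ?case using I by (intro computes_Assign) auto
    next
      case (2 \<mu>'')
      then have \<tau>': "\<mu>'' (''tau'', [i]) = \<tau> i" using \<tau> by simp
      show ?case
      proof (rule computes_For[where I = "?J i" and N = 5], goal_cases)
        case (2 m \<mu>3)
        then have "m \<ge> 1" "\<mu>3 (''tau'', [i]) = \<tau> i" using \<tau>' by auto
        then show ?case
          using 2 poly_legendre_rec[of m "\<tau> i"]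
          by (intro computes_Assign[where v = "poly (legendre m) (\<tau> i)"]) (auto simp: less_Suc_eq)
      qed (use 2 in \<open>auto simp: n less_Suc_eq_le le_less\<close>)
    qed simp
  qed (auto simp: n power2_eq_square less_Suc_eq_le)
qed

text \<open>The coefficient of \<open>y\<^bsup>n-k+1\<^esup>\<close> in \<open>P\<^sub>n\<close> is stored in column \<open>n - k + 2\<close> of \<open>L\<close>. The auxiliary
  coefficient \<open>b\<^sub>n = 0\<close> starts the recurrence.\<close>

definition synthetic_division :: com where
  "synthetic_division =
     For ''i'' (Const 1) (Var ''n'') (
       Assign ''B'' [Var ''i'', Var ''n''] (Num (Const 0)) ;;
       For ''k'' (Const 1) (Var ''n'') (
         Assign ''B'' [Var ''i'', Minus (Var ''n'') (Var ''k'')]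
           (Op Add
             (Get ''L'' [Var ''n'', Plus (Minus (Var ''n'') (Var ''k'')) (Const 2)])
             (Op Mul (Op Add (Get ''tau'' [Var ''i'']) (Num (Const 1)))
               (Get ''B'' [Var ''i'', Plus (Minus (Var ''n'') (Var ''k'')) (Const 1)])))))"

text \<open>Before step \<open>k\<close> the coefficients with index at least \<open>n + 1 - k\<close> are known, and the step
  itself is \<open>coeff_legendre_quotient_rec\<close>.\<close>

lemma computes_synthetic_division:
  assumes n: "\<nu> ''n'' = n" and tau: "\<forall>i\<in>{1..n}. \<mu> (''tau'', [i]) = \<tau> i"
    and root: "\<forall>i\<in>{1..n}. poly (legendre n) (\<tau> i) = 0"
    and L: "\<forall>j\<le>Suc n. \<mu> (''L'', [n, j]) = legendre_entry n j"
  shows "computes synthetic_division \<nu> \<mu> (3 * n^2)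
    (\<lambda>\<mu>'. \<forall>i\<in>{1..n}. \<forall>k\<le>n. \<mu>' (''B'', [i, k]) = quot_coeff n \<tau> i k)"
proof -
  let ?I = "\<lambda>i \<mu>'. \<forall>i'\<in>{1..<i}. \<forall>k\<le>n. \<mu>' (''B'', [i', k]) = quot_coeff n \<tau> i' k"
  let ?J = "\<lambda>i k \<mu>'. ?I i \<mu>' \<and> (\<forall>l\<in>{Suc n - k..n}. \<mu>' (''B'', [i, l]) = quot_coeff n \<tau> i l)"
  show ?thesis
    unfolding synthetic_division_def
  proof (rule computes_For[where I = ?I and N = "3 * n"], goal_cases)
    case (2 i \<mu>')
    then have i: "i \<in> {1..n}" "n \<ge> 1" and \<tau>: "\<mu>' (''tau'', [i]) = \<tau> i" and I: "?I i \<mu>'"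
      and L': "\<forall>j\<le>Suc n. \<mu>' (''L'', [n, j]) = legendre_entry n j"
      using tau L by (auto simp: n)
    have q: "quot_coeff n \<tau> i = coeff (legendre_quotient n (\<tau> i))"
      using quot_coeff_eq root i by blast
    show ?case
    proof (rule computes_Seq[where R = "?J i 1" and Na = 0 and Nb = "3 * n"], goal_cases)
      case 1
      show ?case
        using I i by (intro computes_Assign) (auto simp: n q coeff_legendre_quotient_ge)
    next
      case (2 \<mu>'')
      then have \<tau>': "\<mu>'' (''tau'', [i]) = \<tau> i"
        and L'': "\<forall>j\<le>Suc n. \<mu>'' (''L'', [n, j]) = legendre_entry n j"
        using \<tau> L' by auto
      show ?case
      proof (rule computes_For[where I = "?J i" and N = 3], goal_cases)
        case (2 k \<mu>3)
        then have k: "1 \<le> k" "k \<le> n" "Suc n - k = Suc (n - k)" "Suc n - Suc k = n - k"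
          by (auto simp: n)
        have B: "\<mu>3 (''B'', [i, Suc (n - k)]) = quot_coeff n \<tau> i (Suc (n - k))"
          using 2 k by auto
        have L3: "\<mu>3 (''L'', [n, Suc (Suc (n - k))]) = coeff (legendre_at_m1 n) (Suc (n - k))"
          using 2 k L'' by (auto simp: legendre_entry_def)
        have "quot_coeff n \<tau> i (n - k) = coeff (legendre_at_m1 n) (Suc (n - k)) +
            (\<tau> i + 1) * quot_coeff n \<tau> i (Suc (n - k))"
          unfolding q using root i by (intro coeff_legendre_quotient_rec) auto
        moreover have "\<mu>3 (''tau'', [i]) = \<tau> i" using 2 \<tau>' by simp
        ultimately show ?case
          using 2 k B L3
          by (intro computes_Assign[where v = "quot_coeff n \<tau> i (n - k)"])
             (auto simp: n Suc_le_eq le_less)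
      qed (use 2 in \<open>auto simp: n less_Suc_eq\<close>)
    qed simp
  qed (auto simp: n power2_eq_square less_Suc_eq_le)
qed

text \<open>The whole table is cleared first, which costs no arithmetic operations. This fills column \<open>0\<close> and
  the boundary rows \<open>0\<close> and \<open>n + 1\<close>, up to the entry \<open>1\<close> at \<open>(0, 0)\<close>.\<close>

definition gl_G_table :: com where
  "gl_G_table =
     For ''i'' (Const 0) (Plus (Var ''n'') (Const 1)) (
       For ''k'' (Const 0) (Var ''n'') (Assign ''G'' [Var ''i'', Var ''k''] (Num (Const 0)))) ;;
     Assign ''G'' [Const 0, Const 0] (Num (Const 1)) ;;
     For ''i'' (Const 1) (Var ''n'') (
       For ''k'' (Const 1) (Var ''n'') (
         Assign ''G'' [Var ''i'', Var ''k'']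
           (Op Mul
             (Op Mul (Op Div (Num (Var ''n'')) (Num (Const 2)))
               (Get ''P'' [Var ''i'', Minus (Var ''n'') (Const 1)]))
             (Op Mul (Op Div (Num (Const 1)) (Num (Var ''k'')))
               (Get ''B'' [Var ''i'', Minus (Var ''k'') (Const 1)])))))"

lemma computes_gl_G_table:
  assumes n: "\<nu> ''n'' = n"
    and P: "\<forall>i\<in>{1..n}. \<mu> (''P'', [i, n - 1]) = poly (legendre (n - 1)) (\<tau> i)"
    and B: "\<forall>i\<in>{1..n}. \<forall>k\<le>n. \<mu> (''B'', [i, k]) = quot_coeff n \<tau> i k"
  shows "computes gl_G_table \<nu> \<mu> (5 * n^2)
    (\<lambda>\<mu>'. \<forall>i\<le>Suc n. \<forall>k\<le>n. \<mu>' (''G'', [i, k]) = gl_G_coeff n \<tau> i k)"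
proof -
  let ?Z = "\<lambda>i \<mu>'. \<forall>i'<i. \<forall>k\<le>n. \<mu>' (''G'', [i', k]) = 0"
  let ?I = "\<lambda>i \<mu>'. \<forall>i'\<le>Suc n. \<forall>k\<le>n. \<mu>' (''G'', [i', k]) =
     (if i' = 0 \<or> k = 0 \<or> i' < i then gl_G_coeff n \<tau> i' k else 0)"
  \<comment> \<open>The entries that are not yet reached are still zero, except that row \<open>0\<close> and column \<open>0\<close>
    have their final values from the start.\<close>
  let ?J = "\<lambda>i k \<mu>'. \<forall>i'\<le>Suc n. \<forall>k'\<le>n. \<mu>' (''G'', [i', k']) =
     (if i' = 0 \<or> k' = 0 \<or> i' < i \<or> i' = i \<and> k' < k then gl_G_coeff n \<tau> i' k' else 0)"
  show ?thesis
    unfolding gl_G_table_def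
  proof (rule computes_Seq[where R = "?Z (n + 2)" and Na = 0 and Nb = "5 * n^2"], goal_cases)
    case 1
    show ?case
    proof (rule computes_For[where I = ?Z and N = 0], goal_cases)
      case (2 i \<mu>')
      show ?case
      proof (rule computes_For[where N = 0 and
            I = "\<lambda>k \<mu>'. ?Z i \<mu>' \<and> (\<forall>k'<k. \<mu>' (''G'', [i, k']) = 0)"], goal_cases)
        case (2 k \<mu>'')
        then show ?case by (intro computes_Assign) (auto simp: less_Suc_eq)
      qed (use 2 in \<open>auto simp: n less_Suc_eq_le le_less\<close>)
    qed (auto simp: n)
  next
    case (2 \<mu>1)
    show ?case
    proof (rule computes_Seq[where R = "?I 1" and Na = 0 and Nb = "5 * n^2"], goal_cases)
      case 1
      show ?case
        using 2 by (intro computes_Assign) (auto simp: gl_G_coeff_def)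
    next
      case (2 \<mu>2)
      have P2: "\<forall>i\<in>{1..n}. \<mu>2 (''P'', [i, n - 1]) = poly (legendre (n - 1)) (\<tau> i)"
        and B2: "\<forall>i\<in>{1..n}. \<forall>k\<le>n. \<mu>2 (''B'', [i, k]) = quot_coeff n \<tau> i k"
        using 2 \<open>\<And>a js. a \<notin> _ \<Longrightarrow> \<mu>1 (a, js) = \<mu> (a, js)\<close> P B by auto
      show ?case
      proof (rule computes_For[where I = ?I and N = "5 * n"], goal_cases)
        case (2 i \<mu>3)
        then have i: "1 \<le> i" "i \<le> n" by (auto simp: n)
        have "\<mu>3 (''P'', [i, n - 1]) = poly (legendre (n - 1)) (\<tau> i)"
          and B3: "\<forall>k\<le>n. \<mu>3 (''B'', [i, k]) = quot_coeff n \<tau> i k"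
          using P2 B2 2 i by auto
        note row = 2(3) this
        show ?case
        proof (rule computes_For[where I = "?J i" and N = 5], goal_cases)
          case (2 k \<mu>4)
          then have k: "1 \<le> k" "k \<le> n" by (auto simp: n)
          have "gl_G_coeff n \<tau> i k =
              real n / 2 * \<mu>4 (''P'', [i, n - 1]) * (1 / real k * \<mu>4 (''B'', [i, k - 1]))"
            using row 2 i k by (auto simp: gl_G_coeff_def)
          then show ?case
            using 2(3) i k
            by (intro computes_Assign[where v = "gl_G_coeff n \<tau> i k"]) (auto simp: n less_Suc_eq)
        qed (use row i in \<open>auto simp: n less_Suc_eq_le le_less\<close>)
      next
        case (5 \<mu>3)
        then show ?case by (auto simp: n gl_G_coeff_def less_Suc_eq_le le_Suc_eq)
      qed (use 2 in \<open>auto simp: n power2_eq_square\<close>)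
    qed simp
  qed simp
qed

definition gl_differences :: com where
  "gl_differences =
     For ''i'' (Const 0) (Var ''n'') (
       For ''k'' (Const 0) (Var ''n'') (
         Assign ''A'' [Var ''i'', Var ''k'']
           (Op Sub (Get ''G'' [Var ''i'', Var ''k''])
             (Get ''G'' [Plus (Var ''i'') (Const 1), Var ''k'']))))"

lemma computes_gl_differences:
  assumes n: "\<nu> ''n'' = n" "n \<ge> 1"
    and G: "\<forall>i\<le>Suc n. \<forall>k\<le>n. \<mu> (''G'', [i, k]) = gl_G_coeff n \<tau> i k"
  shows "computes gl_differences \<nu> \<mu> (4 * n^2)
    (\<lambda>\<mu>'. \<forall>i\<in>{0..n}. \<forall>k\<in>{0..n}. \<mu>' (''A'', [i, k]) = gl_coeff n \<tau> i k)"
proof -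
  let ?I = "\<lambda>i \<mu>'. \<forall>i'<i. \<forall>k\<le>n. \<mu>' (''A'', [i', k]) = gl_coeff n \<tau> i' k"
  have "Suc n * Suc n \<le> (2 * n) * (2 * n)"
    using n(2) by (intro mult_le_mono) auto
  then have cost: "Suc n * Suc n \<le> 4 * n^2"
    by (simp add: power2_eq_square)
  show ?thesis
    unfolding gl_differences_def
  proof (rule computes_For[where I = ?I and N = "Suc n"], goal_cases)
    case (2 i \<mu>1)
    show ?case
    proof (rule computes_For[where N = 1 and
          I = "\<lambda>k \<mu>'. ?I i \<mu>' \<and> (\<forall>k'<k. \<mu>' (''A'', [i, k']) = gl_coeff n \<tau> i k')"], goal_cases)
      case (2 k \<mu>2)
      then have "gl_coeff n \<tau> i k = \<mu>2 (''G'', [i, k]) - \<mu>2 (''G'', [Suc i, k])"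
        using \<open>i \<le> _\<close> \<open>\<And>a js. a \<notin> _ \<Longrightarrow> \<mu>1 (a, js) = \<mu> (a, js)\<close> G n(2)
        by (auto simp: n(1) gl_coeff_eq_diff)
      then show ?case
        using 2
        by (intro computes_Assign[where v = "gl_coeff n \<tau> i k"]) (auto simp: less_Suc_eq)
    qed (use 2 in \<open>auto simp: n less_Suc_eq_le le_less\<close>)
  qed (use cost in \<open>auto simp: n less_Suc_eq_le\<close>)
qed

definition gl_coeffs :: com where
  "gl_coeffs =
     legendre_table ;; legendre_values ;; synthetic_division ;; gl_G_table ;; gl_differences"

lemma written_gl_coeffs: "written gl_coeffs = {''L'', ''P'', ''B'', ''G'', ''A''}"
  by (auto simp: gl_coeffs_def legendre_table_def legendre_row_def legendre_values_def
      synthetic_division_def gl_G_table_def gl_differences_def)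

lemma computes_gl_coeffs:
  assumes n: "\<nu> ''n'' = n" "n \<ge> 1"
    and tau: "\<forall>i\<in>{1..n}. \<mu> (''tau'', [i]) = \<tau> i"
    and root: "\<forall>i\<in>{1..n}. poly (legendre n) (\<tau> i) = 0"
  shows "computes gl_coeffs \<nu> \<mu> (27 * n^2)
    (\<lambda>\<mu>'. \<forall>i\<in>{0..n}. \<forall>k\<in>{0..n}. \<mu>' (''A'', [i, k]) = gl_coeff n \<tau> i k)"
  unfolding gl_coeffs_def
proof (rule computes_Seq[OF computes_legendre_table[of \<nu> n, OF n], where Nb = "17 * n^2"], goal_cases)
  case (1 \<mu>1)
  then have tau1: "\<forall>i\<in>{1..n}. \<mu>1 (''tau'', [i]) = \<tau> i"
    using tau by (simp add: legendre_table_def legendre_row_def)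
  show ?case
  proof (rule computes_Seq[OF computes_legendre_values[of \<nu> n, OF n(1) tau1],
        where Nb = "12 * n^2"], goal_cases)
    case (1 \<mu>2)
    then have tau2: "\<forall>i\<in>{1..n}. \<mu>2 (''tau'', [i]) = \<tau> i"
      and L2: "\<forall>j\<le>Suc n. \<mu>2 (''L'', [n, j]) = legendre_entry n j"
      using tau1 \<open>\<forall>m\<le>n. \<forall>j\<le>Suc n. \<mu>1 (''L'', [m, j]) = _ m j\<close>
      by (simp_all add: legendre_values_def)
    show ?case
    proof (rule computes_Seq[OF computes_synthetic_division[of \<nu> n, OF n(1) tau2 root L2],
        where Nb = "9 * n^2"],
        goal_cases)
      case (1 \<mu>3)
      then have P3: "\<forall>i\<in>{1..n}. \<mu>3 (''P'', [i, n - 1]) = poly (legendre (n - 1)) (\<tau> i)"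
        using \<open>\<forall>i\<in>{1..n}. \<forall>m\<le>n. \<mu>2 (''P'', [i, m]) = _ m i\<close>
        by (simp add: synthetic_division_def)
      show ?case
        by (rule computes_Seq[OF computes_gl_G_table[of \<nu> n, OF n(1) P3 1(1)]
              computes_gl_differences[of \<nu> n, OF n]]) (simp_all add: algebra_simps)
    qed simp
  qed simp
qed simp

section \<open>Evaluation\<close>

text \<open>After \<open>k\<close> iterations of the inner loop, counting the initial assignment as the first, the
  accumulator is the polynomial formed by the \<open>k\<close> leading coefficients, divided by the power of
  \<open>t + 1\<close> that the remaining iterations supply.\<close>

lemma computes_horner:
  assumes n: "\<nu> ''n'' = n" "n \<ge> 1" and t: "\<mu> (''t'', []) = t"
    and A: "\<forall>i\<in>{0..n}. \<forall>k\<in>{0..n}. \<mu> (''A'', [i, k]) = a i k"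
  shows "computes horner \<nu> \<mu> (5 * n^2)
    (\<lambda>\<mu>'. \<forall>i\<in>{0..n}. \<mu>' (''F'', [i]) = (\<Sum>k\<le>n. a i k * (t + 1) ^ k))"
proof -
  let ?H = "\<lambda>i k. \<Sum>j<k. a i (n - j) * (t + 1) ^ (k - Suc j)"
  let ?I = "\<lambda>i \<mu>'. \<forall>i'<i. \<mu>' (''F'', [i']) = ?H i' (Suc n)"
  have H_Suc: "?H i (Suc k) = ?H i k * (t + 1) + a i (n - k)" for i k
  proof -
    have "(t + 1) ^ (k - j) = (t + 1) ^ (k - Suc j) * (t + 1)" if "j < k" for j
      using that by (metis Suc_diff_Suc power_Suc2)
    then show ?thesis by (simp add: sum_distrib_right mult.assoc)
  qed
  have H_final: "?H i (Suc n) = (\<Sum>k\<le>n. a i k * (t + 1) ^ k)" for i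
    using sum.nat_diff_reindex[of "\<lambda>k. a i k * (t + 1) ^ k" "Suc n"]
    by (simp add: lessThan_Suc_atMost)
  have cost: "1 + Suc n * (n * 2) \<le> 5 * n^2"
  proof -
    have "n \<le> n * n" by simp
    then have "1 + Suc n * (n * 2) \<le> 5 * (n * n)"
      using n(2) unfolding mult_Suc by linarith
    then show ?thesis by (simp add: power2_eq_square)
  qed
  show ?thesis
    unfolding horner_def
  proof (rule computes_Seq[where R = "\<lambda>\<mu>'. \<mu>' (''y'', []) = t + 1" and Na = 1 and
        Nb = "Suc n * (n * 2)"], goal_cases)
    case 1
    show ?case by (rule computes_Assign[where v = "t + 1"]) (simp_all add: t)
  next
    case (2 \<mu>1)
    then have y: "\<mu>1 (''y'', []) = t + 1"
      and A1: "\<forall>i\<in>{0..n}. \<forall>k\<in>{0..n}. \<mu>1 (''A'', [i, k]) = a i k"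
      using A by simp_all
    show ?case
    proof (rule computes_For[where I = ?I and N = "n * 2"], goal_cases)
      case (2 i \<mu>2)
      then have y2: "\<mu>2 (''y'', []) = t + 1" and A2: "\<forall>k\<in>{0..n}. \<mu>2 (''A'', [i, k]) = a i k"
        using A1 y by (auto simp: n)
      let ?J = "\<lambda>k \<mu>'. ?I i \<mu>' \<and> \<mu>' (''F'', [i]) = ?H i k"
      show ?case
      proof (rule computes_Seq[where R = "?J 1" and Na = 0 and Nb = "n * 2"], goal_cases)
        case 1
        show ?case
          using 2 A2 by (intro computes_Assign[where v = "a i n"]) (auto simp: n)
      next
        case (2 \<mu>3)
        then have y3: "\<mu>3 (''y'', []) = t + 1" and A3: "\<forall>k\<in>{0..n}. \<mu>3 (''A'', [i, k]) = a i k"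
          using y2 A2 by simp_all
        show ?case
        proof (rule computes_For[where I = ?J and N = 2], goal_cases)
          case (2 k \<mu>4)
          then have "\<mu>4 (''y'', []) = t + 1" "\<mu>4 (''A'', [i, n - k]) = a i (n - k)"
            using y3 A3 by simp_all
          then show ?case
            using 2(3) H_Suc[of i k]
            by (intro computes_Assign[where v = "?H i (Suc k)"])
               (auto simp: n simp del: sum.lessThan_Suc)
        qed (use 2 in \<open>auto simp: n less_Suc_eq simp del: sum.lessThan_Suc\<close>)
      qed simp
    next
      case (5 \<mu>2)
      then show ?case unfolding H_final by (auto simp: n less_Suc_eq_le)
    qed (use n in auto)
  qed (use cost in simp)
qed

lemma computes_combine:
  assumes n: "\<nu> ''n'' = n" "n \<ge> 1" and d: "\<nu> ''d'' = d"
    and W: "\<forall>i\<in>{0..n}. \<forall>j\<in>{1..d}. \<mu> (''W'', [i, j]) = W i j"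
    and F: "\<forall>i\<in>{0..n}. \<mu> (''F'', [i]) = f i"
  shows "computes combine \<nu> \<mu> (3 * (d * n))
    (\<lambda>\<mu>'. \<forall>j\<in>{1..d}. \<mu>' (''X'', [j]) = (\<Sum>i\<le>n. W i j * f i))"
proof -
  let ?I = "\<lambda>j \<mu>'. \<forall>j'\<in>{1..<j}. \<mu>' (''X'', [j']) = (\<Sum>i\<le>n. W i j' * f i)"
  show ?thesis
    unfolding combine_def
  proof (rule computes_For[where I = ?I and N = "3 * n"], goal_cases)
    case (2 j \<mu>1)
    then have j: "j \<in> {1..d}" by (auto simp: d)
    have W1: "\<forall>i\<le>n. \<mu>1 (''W'', [i, j]) = W i j" and F1: "\<forall>i\<le>n. \<mu>1 (''F'', [i]) = f i"
      using 2 j W F by auto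
    let ?J = "\<lambda>k \<mu>'. ?I j \<mu>' \<and> \<mu>' (''X'', [j]) = (\<Sum>i<k. W i j * f i)"
    show ?case
    proof (rule computes_Seq[where R = "?J 1" and Na = 1 and Nb = "n * 2"], goal_cases)
      case 1
      show ?case
        using 2 W1 F1 by (intro computes_Assign[where v = "W 0 j * f 0"]) auto
    next
      case (2 \<mu>2)
      then have W2: "\<forall>i\<le>n. \<mu>2 (''W'', [i, j]) = W i j" and F2: "\<forall>i\<le>n. \<mu>2 (''F'', [i]) = f i"
        using W1 F1 by simp_all
      show ?case
      proof (rule computes_For[where I = ?J and N = 2], goal_cases)
        case (2 k \<mu>3)
        then have "\<mu>3 (''W'', [k, j]) = W k j" "\<mu>3 (''F'', [k]) = f k"
          using W2 F2 by (simp_all add: n)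
        then show ?case
          using 2(3) by (intro computes_Assign[where v = "\<Sum>i<Suc k. W i j * f i"]) auto
      qed (use 2 in \<open>auto simp: n less_Suc_eq lessThan_Suc_atMost\<close>)
    qed (use n in simp)
  qed (auto simp: d)
qed

theorem corollary4p4:
  shows
   "(\<forall>(n::nat) (\<tau> :: nat \<Rightarrow> real) (t::real).
       n \<ge> 1 \<longrightarrow> legendre_zeros n \<tau> \<longrightarrow> -1 < t \<longrightarrow> t < 1 \<longrightarrow>
         (\<forall>i\<in>{1..n-1}. gl_F n \<tau> i t =
            (\<Sum>k=1..n. real n / (2 * real k) *
               (poly (legendre (n-1)) (\<tau> i) * quot_coeff n \<tau> i (k-1)
                - poly (legendre (n-1)) (\<tau> (i+1)) * quot_coeff n \<tau> (i+1) (k-1)) * (t+1)^k)) \<and>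
         gl_F n \<tau> 0 t =
           1 - real n / 2 * poly (legendre (n-1)) (\<tau> 1) *
                 (\<Sum>k=1..n. 1 / real k * quot_coeff n \<tau> 1 (k-1) * (t+1)^k) \<and>
         gl_F n \<tau> n t =
           real n / 2 * poly (legendre (n-1)) (\<tau> n) *
                 (\<Sum>k=1..n. 1 / real k * quot_coeff n \<tau> n (k-1) * (t+1)^k)) \<and>
    (\<exists>(coeffs :: com) (C::nat).
       \<forall>(n::nat) (\<tau> :: nat \<Rightarrow> real) (t::real) (\<nu> :: env) (\<mu> :: mem).
         n \<ge> 1 \<longrightarrow> legendre_zeros n \<tau> \<longrightarrow> -1 < t \<longrightarrow> t < 1 \<longrightarrow> eval_input n \<tau> t \<nu> \<mu> \<longrightarrow>
           computes coeffs \<nu> \<mu> (C * n^2)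
             (\<lambda>\<mu>'. \<forall>i\<in>{0..n}. \<forall>k\<in>{0..n}. \<mu>' (''A'', [i, k]) = gl_coeff n \<tau> i k) \<and>
           computes (coeffs ;; horner) \<nu> \<mu> (C * n^2)
             (\<lambda>\<mu>'. \<forall>i\<in>{0..n}. \<mu>' (''F'', [i]) = gl_F n \<tau> i t) \<and>
           (\<forall>(d::nat) (W :: nat \<Rightarrow> nat \<Rightarrow> real). d \<ge> 1 \<longrightarrow> curve_input n d W \<nu> \<mu> \<longrightarrow>
              computes (coeffs ;; horner ;; combine) \<nu> \<mu> (C * (n^2 + d * n))
                (\<lambda>\<mu>'. \<forall>j\<in>{1..d}. \<mu>' (''X'', [j]) = gl_curve n \<tau> W t j)))"
  (* 27 n^2 operations for the coefficients and 5 n^2 for Horner's scheme; the combination needs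
     only 3 d n. *)
proof (intro conjI allI impI exI[of _ gl_coeffs] exI[of _ "32 :: nat"], goal_cases)
  case (1 n \<tau> t)
  then show ?case by (intro ballI gl_F_representation(1)) auto
next
  case (2 n \<tau> t)
  then show ?case by (intro gl_F_representation(2)) auto
next
  case (3 n \<tau> t)
  then show ?case by (intro gl_F_representation(3)) auto
next
  case (4 n \<tau> t \<nu> \<mu>)
  then show ?case
    by (intro computes_frame[OF computes_gl_coeffs[of \<nu> n]])
       (auto simp: eval_input_def legendre_zeros_root)
next
  case (5 n \<tau> t \<nu> \<mu>)
  have "computes (gl_coeffs ;; horner) \<nu> \<mu> (27 * n^2 + 5 * n^2)
    (\<lambda>\<mu>'. \<forall>i\<in>{0..n}. \<mu>' (''F'', [i]) = (\<Sum>k\<le>n. gl_coeff n \<tau> i k * (t + 1) ^ k))"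
    using 5
    by (intro computes_Seq[OF computes_gl_coeffs[of \<nu> n] computes_horner])
       (auto simp: eval_input_def legendre_zeros_root written_gl_coeffs)
  then show ?case
    by (rule computes_frame) (use 5 in \<open>auto simp: gl_F_eq_sum\<close>)
next
  case (6 n \<tau> t \<nu> \<mu> d W)
  have n: "\<nu> ''n'' = n" "n \<ge> 1" and d: "\<nu> ''d'' = d"
    using 6 by (auto simp: eval_input_def curve_input_def)
  have "computes (gl_coeffs ;; horner ;; combine) \<nu> \<mu> (27 * n^2 + (5 * n^2 + 3 * (d * n)))
    (\<lambda>\<mu>'. \<forall>j\<in>{1..d}. \<mu>' (''X'', [j]) = (\<Sum>i\<le>n. W i j * (\<Sum>k\<le>n. gl_coeff n \<tau> i k * (t + 1) ^ k)))"
  proof (rule computes_Seq[OF computes_gl_coeffs[of \<nu> n, OF n, of _ \<tau>],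
        where Nb = "5 * n^2 + 3 * (d * n)"], goal_cases)
    case (3 \<mu>1)
    then have t1: "\<mu>1 (''t'', []) = t"
      and W1: "\<forall>i\<in>{0..n}. \<forall>j\<in>{1..d}. \<mu>1 (''W'', [i, j]) = W i j"
      using 6 by (auto simp: eval_input_def curve_input_def written_gl_coeffs)
    show ?case
      by (rule computes_Seq[OF computes_horner[of \<nu> n, OF n t1 3(1)]
            computes_combine[of \<nu> n, OF n d]])
         (use W1 in \<open>auto simp: horner_def\<close>)
  qed (use 6 in \<open>auto simp: eval_input_def legendre_zeros_root\<close>)
  then show ?case
    by (rule computes_frame) (use 6 in \<open>auto simp: gl_F_eq_sum gl_curve_def algebra_simps\<close>)
qed

end
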